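(* Let $\hat P_{N,\rho,A}$ be the program defined in the context and $\mathcal K:=\{(j,k,i): i\in\mathcal N,\ k\in\mathcal T,\ j\in\mathcal M_i\}$. (i) Suppose that for each $k\in\mathcal T$ the candidate reachable sets are $p$-normed balls $\mathcal R_k(c_k,r_k)=\{x\in\mathbb R^{n_x}:\|x-c_k\|_p\le r_k\}$ with center $c_k\in\mathbb R^{n_x}$ and radius $r_k\in\mathbb R_{\ge0}$, and that $S(\mathcal R_k(c_k,r_k))=\mathrm{Vol}(\mathcal R_k(c_k,r_k))$. Write $c=(c_k)_{k\in\mathcal T}$, $r=(r_k)_{k\in\mathcal T}$, $\xi=(\xi_i)_{i\in\mathcal N}$. Then $\hat P_{N,\rho,A}$ can be written as $$\min_{(c,r,\xi)\in\mathbb R^{n_x(T+1)}\times\mathbb R^{T+1}_{\ge0}\times\mathbb R^N_{\ge0}}\ \sum_{k\in\mathcal T}\Big(\mathrm{Vol}(\mathbb B_p^{n_x})\,r_k^{n_x}+\rho\sum_{i\in\mathcal N}\xi_i\Big)\quad\text{s.t.}\quad\|x_k^{(i,j)}-c_k\|_p\le r_k+\xi_i,\ \ \forall(j,k,i)\in\mathcal K.$$ (ii) Suppose that for each $k\in\mathcal T$ the candidate reachable sets are ellipsoids $\mathcal R_k(C_k,b_k)=\{x\in\mathbb R^{n_x}:\|C_kx+b_k\|_2\le1\}$ with $C_k\in\mathbb S^{n_x}_{\succ0}$ and $b_k\in\mathbb R^{n_x}$, and that $S(\mathcal R_k(C_k,b_k))=\mathrm{Vol}(\mathcal R_k(C_k,b_k))$.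 Write $C=(C_k)_{k\in\mathcal T}$, $b=(b_k)_{k\in\mathcal T}$, $\xi=(\xi_i)_{i\in\mathcal N}$. Then $\hat P_{N,\rho,A}$ can be written as $$\min_{(C,b)\in\prod_{k\in\mathcal T}\mathbb S^{n_x}_{\succ0}\times\mathbb R^{n_x},\ \xi\in\mathbb R^N_{\ge0}}\ \sum_{k\in\mathcal T}\Big(\frac{\mathrm{Vol}(\mathbb B_2^{n_x})}{\det(C_k)}+\rho\sum_{i\in\mathcal N}\xi_i\Big)\quad\text{s.t.}\quad\|C_kx_k^{(i,j)}+b_k\|_2\le1+\xi_i,\ \ \forall(j,k,i)\in\mathcal K.$$
   Context: $\mathcal T=\{0,\dots,T\}$, $\mathcal N=\{1,\dots,N\}$. Sampled trajectories are $x^{(i)}=(x_k^{(i)})_{k\in\mathcal T}$, $x_k^{(i)}\in\mathbb R^{n_x}$. For each $i\in\mathcal N$, $x^{(i,j)}=(x_k^{(i,j)})_{k\in\mathcal T}$, $j\in\mathcal M_i$ ($\mathcal M_i$ finite), are given points in trajectory space: the vertices of a polytopic approximation of the set of adversarial perturbations of $x^{(i)}$. $\rho>0$ is a penalty parameter. Candidate reachable sets are $\mathcal R_k(\theta_k)=\{z\in\mathbb R^{n_x}: g_k(z,\theta_k)\le0\}$, with $\theta=(\theta_k)_{k\in\mathcal T}\in\Theta$ and $g(x,\theta)=\max_{k\in\mathcal T}g_k(x_k,\theta_k)$; $S(\mathcal R_k(\theta_k))$ is a size proxy. The program $\hat P_{N,\rho,A}$ is $$\min_{\theta\in\Theta,\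 \xi\in\mathbb R^N_{\ge0}}\ \sum_{k\in\mathcal T}\Big[S(\mathcal R_k(\theta_k))+\rho\sum_{i\in\mathcal N}\xi_i\Big]\quad\text{s.t.}\quad g(x^{(i,j)},\theta)\le\xi_i,\ \ \forall j\in\mathcal M_i,\ \forall i\in\mathcal N.$$ The constraint functions are, for $p$-normed balls, $g_k(z,(c_k,r_k))=\|z-c_k\|_p-r_k$ and, for ellipsoids, $g_k(z,(C_k,b_k))=\|C_kz+b_k\|_2-1$. $\mathbb B_p^{n_x}$ is the unit $p$-norm ball of $\mathbb R^{n_x}$, $\mathrm{Vol}$ is volume, and $\mathbb S^{n_x}_{\succ0}$ is the set of symmetric positive definite $n_x\times n_x$ matrices. "Can be written as" means that the two programs are equivalent. *)

theory Defs
  imports "HOL-Analysis.Analysis"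
begin

record 'v program =
  feasible :: "'v set"
  objective :: "'v \<Rightarrow> real"

text \<open>
  Two minimization programs are equivalent via an explicit change of decision variables: it maps the
  feasible set of the first bijectively onto that of the second and preserves the objective. The two
  lemmas below record that optimal values and optimal solutions then correspond.
\<close>

definition equivalent_via :: "('v \<Rightarrow> 'w) \<Rightarrow> 'v program \<Rightarrow> 'w program \<Rightarrow> bool" where
  "equivalent_via \<phi> P Q \<longleftrightarrow>
     bij_betw \<phi> (feasible P) (feasible Q) \<and>
     (\<forall>v\<in>feasible P. objective Q (\<phi> v) = objective P v)"

definition minimizers :: "'v program \<Rightarrow> 'v set" where
  "minimizers P = {v \<in> feasible P. \<forall>w\<in>feasible P. objective P v \<le> objective P w}"

lemma equivalent_via_values:
  assumes "equivalent_via \<phi> P Q"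
  shows "objective Q ` feasible Q = objective P ` feasible P"
proof -
  have "feasible Q = \<phi> ` feasible P"
    using assms by (auto simp: equivalent_via_def bij_betw_def)
  then show ?thesis
    using assms by (auto simp: equivalent_via_def image_image)
qed

lemma equivalent_via_minimizers:
  assumes "equivalent_via \<phi> P Q"
  shows "minimizers Q = \<phi> ` minimizers P"
proof -
  have "feasible Q = \<phi> ` feasible P"
    using assms by (auto simp: equivalent_via_def bij_betw_def)
  then show ?thesis
    using assms by (auto simp: equivalent_via_def minimizers_def)
qed

text \<open>
  Families indexed by \<open>{0..T}\<close> or \<open>{1..N}\<close> are extensional functions, so that the spaces
  of decision variables are the genuine finite products. Trajectories are functions on \<^typ>\<open>nat\<close>
  of which only the values on \<open>{0..T}\<close> are used.
\<close>

definition reach_set :: "(nat \<Rightarrow> 'x \<Rightarrow> 'p \<Rightarrow> real) \<Rightarrow> nat \<Rightarrow> 'p \<Rightarrow> 'x set" where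
  "reach_set g k \<theta>k = {z. g k z \<theta>k \<le> 0}"

definition traj_constraint ::
  "nat \<Rightarrow> (nat \<Rightarrow> 'x \<Rightarrow> 'p \<Rightarrow> real) \<Rightarrow> (nat \<Rightarrow> 'x) \<Rightarrow> (nat \<Rightarrow> 'p) \<Rightarrow> real" where
  "traj_constraint T g x \<theta> = Max ((\<lambda>k. g k (x k) (\<theta> k)) ` {0..T})"

definition adversarial_program ::
  "nat \<Rightarrow> nat \<Rightarrow> real \<Rightarrow> (nat \<Rightarrow> 'j set) \<Rightarrow> (nat \<Rightarrow> 'j \<Rightarrow> nat \<Rightarrow> 'x)
    \<Rightarrow> ('x set \<Rightarrow> real) \<Rightarrow> (nat \<Rightarrow> 'x \<Rightarrow> 'p \<Rightarrow> real) \<Rightarrow> (nat \<Rightarrow> 'p) set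
    \<Rightarrow> ((nat \<Rightarrow> 'p) \<times> (nat \<Rightarrow> real)) program" where
  "adversarial_program T N \<rho> M x S g \<Theta> =
    \<lparr> feasible = {(\<theta>, \<xi>). \<theta> \<in> \<Theta> \<and> \<xi> \<in> {1..N} \<rightarrow>\<^sub>E {0..} \<and>
        (\<forall>i\<in>{1..N}. \<forall>j\<in>M i. traj_constraint T g (x i j) \<theta> \<le> \<xi> i)},
      objective = (\<lambda>(\<theta>, \<xi>).
        \<Sum>k\<in>{0..T}. (S (reach_set g k (\<theta> k)) + \<rho> * (\<Sum>i\<in>{1..N}. \<xi> i))) \<rparr>"

definition constraint_index :: "nat \<Rightarrow> nat \<Rightarrow> (nat \<Rightarrow> 'j set) \<Rightarrow> ('j \<times> nat \<times> nat) set" where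
  "constraint_index T N M = {(j, k, i). i \<in> {1..N} \<and> k \<in> {0..T} \<and> j \<in> M i}"

text \<open>Regroups \<open>((a\<^sub>k, b\<^sub>k)\<^sub>k, \<xi>)\<close> as \<open>((a\<^sub>k)\<^sub>k, (b\<^sub>k)\<^sub>k, \<xi>)\<close>.\<close>

definition regroup ::
  "nat \<Rightarrow> (nat \<Rightarrow> 'a \<times> 'b) \<times> 'c \<Rightarrow> (nat \<Rightarrow> 'a) \<times> (nat \<Rightarrow> 'b) \<times> 'c" where
  "regroup T = (\<lambda>(\<theta>, \<xi>). (\<lambda>k\<in>{0..T}. fst (\<theta> k), \<lambda>k\<in>{0..T}. snd (\<theta> k), \<xi>))"

abbreviation Vol :: "(real ^ 'n) set \<Rightarrow> real" where
  "Vol A \<equiv> measure lebesgue A"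

text \<open>Only meant for \<open>1 \<le> p \<le> \<infinity>\<close>.\<close>

definition pnorm :: "ereal \<Rightarrow> real ^ 'n \<Rightarrow> real" where
  "pnorm p z = (if p = \<infinity> then infnorm z
     else (\<Sum>l\<in>UNIV. \<bar>z $ l\<bar> powr real_of_ereal p) powr (1 / real_of_ereal p))"

definition unit_pball :: "ereal \<Rightarrow> (real ^ 'n) set" where
  "unit_pball p = {z. pnorm p z \<le> 1}"

definition ball_constraint ::
  "ereal \<Rightarrow> nat \<Rightarrow> real ^ 'n \<Rightarrow> (real ^ 'n) \<times> real \<Rightarrow> real" where
  "ball_constraint p k z = (\<lambda>(c, r). pnorm p (z - c) - r)"

definition ball_params :: "nat \<Rightarrow> (nat \<Rightarrow> (real ^ 'n) \<times> real) set" where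
  "ball_params T = {0..T} \<rightarrow>\<^sub>E UNIV \<times> {0..}"

definition ball_program ::
  "nat \<Rightarrow> nat \<Rightarrow> real \<Rightarrow> (nat \<Rightarrow> 'j set) \<Rightarrow> (nat \<Rightarrow> 'j \<Rightarrow> nat \<Rightarrow> real ^ 'n) \<Rightarrow> ereal
    \<Rightarrow> ((nat \<Rightarrow> real ^ 'n) \<times> (nat \<Rightarrow> real) \<times> (nat \<Rightarrow> real)) program" where
  "ball_program T N \<rho> M x p =
    \<lparr> feasible = {(c, r, \<xi>). c \<in> {0..T} \<rightarrow>\<^sub>E UNIV \<and> r \<in> {0..T} \<rightarrow>\<^sub>E {0..} \<and>
        \<xi> \<in> {1..N} \<rightarrow>\<^sub>E {0..} \<and>
        (\<forall>(j, k, i)\<in>constraint_index T N M. pnorm p (x i j k - c k) \<le> r k + \<xi> i)},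
      objective = (\<lambda>(c, r, \<xi>).
        \<Sum>k\<in>{0..T}. (Vol (unit_pball p :: (real ^ 'n) set) * r k ^ CARD('n)
          + \<rho> * (\<Sum>i\<in>{1..N}. \<xi> i))) \<rparr>"

definition spd_matrices :: "(real ^ 'n ^ 'n) set" where
  "spd_matrices = {C. transpose C = C \<and> (\<forall>v. v \<noteq> 0 \<longrightarrow> 0 < v \<bullet> (C *v v))}"

definition ellipsoid_constraint ::
  "nat \<Rightarrow> real ^ 'n \<Rightarrow> (real ^ 'n ^ 'n) \<times> (real ^ 'n) \<Rightarrow> real" where
  "ellipsoid_constraint k z = (\<lambda>(C, b). norm (C *v z + b) - 1)"

definition ellipsoid_params :: "nat \<Rightarrow> (nat \<Rightarrow> (real ^ 'n ^ 'n) \<times> (real ^ 'n)) set" where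
  "ellipsoid_params T = {0..T} \<rightarrow>\<^sub>E spd_matrices \<times> UNIV"

definition ellipsoid_program ::
  "nat \<Rightarrow> nat \<Rightarrow> real \<Rightarrow> (nat \<Rightarrow> 'j set) \<Rightarrow> (nat \<Rightarrow> 'j \<Rightarrow> nat \<Rightarrow> real ^ 'n)
    \<Rightarrow> ((nat \<Rightarrow> real ^ 'n ^ 'n) \<times> (nat \<Rightarrow> real ^ 'n) \<times> (nat \<Rightarrow> real)) program" where
  "ellipsoid_program T N \<rho> M x =
    \<lparr> feasible = {(C, b, \<xi>). C \<in> {0..T} \<rightarrow>\<^sub>E spd_matrices \<and> b \<in> {0..T} \<rightarrow>\<^sub>E UNIV \<and>
        \<xi> \<in> {1..N} \<rightarrow>\<^sub>E {0..} \<and>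
        (\<forall>(j, k, i)\<in>constraint_index T N M. norm (C k *v x i j k + b k) \<le> 1 + \<xi> i)},
      objective = (\<lambda>(C, b, \<xi>).
        \<Sum>k\<in>{0..T}. (Vol (cball 0 1 :: (real ^ 'n) set) / det (C k)
          + \<rho> * (\<Sum>i\<in>{1..N}. \<xi> i))) \<rparr>"

end

theory Submission
  imports Defs
begin

text \<open>
  Regrouping is a bijection between families of pairs and pairs of families, and it changes neither
  \<open>\<xi>\<close> nor the meaning of the constraints: a maximum over \<open>k\<close> is at most \<open>\<xi>\<^sub>i\<close> exactly when each of its
  terms is, and for both kinds of sets \<open>g\<^sub>k \<le> \<xi>\<^sub>i\<close> is the stated norm inequality with one term moved to
  the other side. This part, \<open>equivalent_via_regroup\<close>, is common to (i) and (ii) and leaves only the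
  two volume formulas to be shown.

  A \<open>p\<close>-norm ball of radius \<open>r\<close> is the image of the unit ball under \<open>z \<mapsto> r z + c\<close>, so the affine
  scaling of Lebesgue measure gives \<open>r ^ n\<close> times the volume of the unit ball; the case \<open>r = 0\<close>
  fits in because the \<open>p\<close>-norm vanishes only at the origin.

  An ellipsoid \<open>\<parallel>C x + b\<parallel> \<le> 1\<close> is the image of a Euclidean unit ball under the inverse of \<open>C\<close>, so its
  volume is that of the ball divided by \<open>\<bar>det C\<bar>\<close>. This needs the determinant formula for the measure
  of linear images over an arbitrary finite index type (\<open>measure_linear_image_cart\<close>, by
  factorization into elementary maps) and the positivity of \<open>det C\<close> (\<open>det_spd_pos\<close>, by deforming
  \<open>C\<close> to the identity).
\<close>

section \<open>Linear images and Lebesgue measure\<close>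

text \<open>
  Lebesgue measure is translation invariant, so boxes may be assumed to have their lower corner at
  the origin. This spares the shear formula a sign condition on the corner and makes the image of a
  box under a coordinate swap easy to name.
\<close>

lemma measure_linear_image_translate_cbox:
  fixes f :: "'a::euclidean_space \<Rightarrow> 'a"
  assumes "linear f"
  shows "measure lebesgue (f ` cbox a b) = measure lebesgue (f ` cbox 0 (b - a))"
proof -
  have "cbox a b = (+) a ` cbox 0 (b - a)"
    using cbox_translation[of a 0 "b - a"] by simp
  then have "f ` cbox a b = (+) (f a) ` f ` cbox 0 (b - a)"
    using assms by (simp add: image_image linear_add)
  then show ?thesis
    by (simp only: measure_translation)
qed

lemma measure_preserving_if_on_corner_boxes:
  fixes f :: "'a::euclidean_space \<Rightarrow> 'a"
  assumes f: "linear f" and S: "S \<in> lmeasurable"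
    and corner: "\<And>b. cbox 0 b \<noteq> {} \<Longrightarrow> measure lebesgue (f ` cbox 0 b) = measure lebesgue (cbox 0 b)"
  shows "f ` S \<in> lmeasurable \<and> measure lebesgue (f ` S) = measure lebesgue S"
proof -
  have "measure lebesgue (f ` cbox a b) = 1 * measure lebesgue (cbox a b)" for a b
  proof -
    have "measure lebesgue (f ` cbox a b) = measure lebesgue (f ` cbox 0 (b - a))"
      by (rule measure_linear_image_translate_cbox[OF f])
    also have "\<dots> = measure lebesgue (cbox 0 (b - a))"
      using corner[of "b - a"] by (cases "cbox 0 (b - a) = {}") simp_all
    also have "\<dots> = measure lebesgue (cbox a b)"
      using measure_linear_image_translate_cbox[of id a b] by (simp add: linear_id)
    finally show ?thesis by simp
  qed
  from measure_linear_sufficient[OF f S this] show ?thesis by simp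
qed

text \<open>
  A swap maps a box to the box with swapped side lengths, whose product is the same.
\<close>

lemma measure_swap:
  fixes S :: "(real ^ 'n) set" and m n :: 'n
  assumes "S \<in> lmeasurable"
  defines "h \<equiv> (\<lambda>v::real ^ 'n. \<chi> i. v $ Transposition.transpose m n i)"
  shows "h ` S \<in> lmeasurable \<and> measure lebesgue (h ` S) = measure lebesgue S"
proof (rule measure_preserving_if_on_corner_boxes[OF _ assms(1)])
  show "linear h"
    unfolding h_def by (rule linearI) (simp_all add: vec_eq_iff)
next
  fix b :: "real ^ 'n"
  assume ne: "cbox 0 b \<noteq> {}"
  have hh: "h (h v) = v" for v
    by (simp add: h_def vec_eq_iff)
  have mem: "h v \<in> cbox 0 (h w) \<longleftrightarrow> v \<in> cbox 0 w" for v w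
    unfolding mem_box_cart h_def by simp (metis transpose_involutory)
  have img: "h ` cbox 0 b = cbox 0 (h b)"
    using mem hh by (metis (no_types, lifting) bij_betw_byWitness equalityI image_subsetI image_eqI subsetI)
  have "(\<Prod>i\<in>UNIV. h b $ i) = (\<Prod>i\<in>UNIV. b $ i)"
    using prod.permute[OF permutes_swap_id, where S=UNIV and g="\<lambda>i. b $ i", of m n]
    by (simp add: h_def o_def)
  moreover have "cbox 0 (h b) \<noteq> {}"
    using ne img by auto
  ultimately show "measure lebesgue (h ` cbox 0 b) = measure lebesgue (cbox 0 b)"
    using ne by (simp add: img content_cbox_cart)
qed

lemma measure_shear:
  fixes S :: "(real ^ 'n) set" and m n :: 'n
  assumes "S \<in> lmeasurable" "m \<noteq> n"
  defines "h \<equiv> (\<lambda>v::real ^ 'n. \<chi> i. if i = m then v $ m + v $ n else v $ i)"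
  shows "h ` S \<in> lmeasurable \<and> measure lebesgue (h ` S) = measure lebesgue S"
proof (rule measure_preserving_if_on_corner_boxes[OF _ assms(1)])
  show "linear h"
    unfolding h_def by (rule linearI) (auto simp: vec_eq_iff algebra_simps)
next
  fix b :: "real ^ 'n"
  assume "cbox 0 b \<noteq> {}"
  then show "measure lebesgue (h ` cbox 0 b) = measure lebesgue (cbox 0 b)"
    unfolding h_def by (rule measure_shear_interval[OF \<open>m \<noteq> n\<close>]) simp
qed

lemma abs_det_swap:
  assumes "m \<noteq> n"
  shows "\<bar>det (matrix (\<lambda>v::real ^ 'n. \<chi> i. v $ Transposition.transpose m n i))\<bar> = 1"
proof -
  have "matrix (\<lambda>v::real ^ 'n. \<chi> i. v $ Transposition.transpose m n i)
      = (\<chi> i. mat 1 $ Transposition.transpose m n i)"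
    by (auto simp: matrix_def mat_def axis_def vec_eq_iff)
  then show ?thesis
    using assms
    by (simp add: det_permute_rows permutes_swap_id sign_swap_id abs_mult)
qed

text \<open>
  The matrix of a shear arises from the identity by adding one row to another. This argument, unlike
  one by triangularity, does not refer to an order on the index type.
\<close>

lemma det_shear:
  assumes "m \<noteq> n"
  shows "det (matrix (\<lambda>v::real ^ 'n. \<chi> i. if i = m then v $ m + v $ n else v $ i)) = 1"
proof -
  have "matrix (\<lambda>v::real ^ 'n. \<chi> i. if i = m then v $ m + v $ n else v $ i)
      = (\<chi> k. if k = m then row m (mat 1) + 1 *s row n (mat 1) else row k (mat 1))"
    by (auto simp: matrix_def mat_def axis_def row_def vec_eq_iff)
  then show ?thesis
    by (simp only: det_row_operation[OF assms] det_I)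
qed

text \<open>
  Both \<open>\<bar>det\<bar>\<close> and the factor by which a linear map scales measure are multiplicative, so it suffices
  to compare them on elementary maps: singular ones (both vanish), diagonal ones, swaps and shears
  (both are \<open>1\<close>).
\<close>

lemma measure_linear_image_cart:
  fixes f :: "real ^ 'n \<Rightarrow> real ^ 'n"
  assumes "linear f" "S \<in> lmeasurable"
  shows "f ` S \<in> lmeasurable \<and> measure lebesgue (f ` S) = \<bar>det (matrix f)\<bar> * measure lebesgue S"
proof -
  define P where "P f \<longleftrightarrow> (\<forall>S\<in>lmeasurable. f ` S \<in> lmeasurable \<and>
      measure lebesgue (f ` S) = \<bar>det (matrix f)\<bar> * measure lebesgue S)"
    for f :: "real ^ 'n \<Rightarrow> real ^ 'n"
  have "P f"
  proof (rule induct_linear_elementary[OF \<open>linear f\<close>])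
    fix f g :: "real ^ 'n \<Rightarrow> real ^ 'n"
    assume lin: "linear f" "linear g" and P: "P f" "P g"
    show "P (f \<circ> g)"
      unfolding P_def
    proof
      fix S :: "(real ^ 'n) set"
      assume "S \<in> lmeasurable"
      then have "g ` S \<in> lmeasurable" "measure lebesgue (g ` S) = \<bar>det (matrix g)\<bar> * measure lebesgue S"
        using P by (simp_all add: P_def)
      moreover from this have "f ` g ` S \<in> lmeasurable"
          "measure lebesgue (f ` g ` S) = \<bar>det (matrix f)\<bar> * measure lebesgue (g ` S)"
        using P by (simp_all add: P_def)
      ultimately show "(f \<circ> g) ` S \<in> lmeasurable \<and>
          measure lebesgue ((f \<circ> g) ` S) = \<bar>det (matrix (f \<circ> g))\<bar> * measure lebesgue S"
        using lin by (simp add: image_comp matrix_compose det_mul abs_mult)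
    qed
  next
    fix f :: "real ^ 'n \<Rightarrow> real ^ 'n" and i
    assume f: "linear f" and "\<And>x. f x $ i = 0"
    \<comment> \<open>the image lies in a coordinate hyperplane\<close>
    then have "\<not> inj f"
      by (metis linear_injective_imp_surjective one_neq_zero surjE vec_component)
    then have "det (matrix f) = 0" "\<And>S. negligible (f ` S)"
      using f det_nz_iff_inj negligible_linear_singular_image by blast+
    then show "P f"
      by (simp add: P_def negligible_iff_measure)
  next
    fix c :: "'n \<Rightarrow> real"
    show "P (\<lambda>x. \<chi> i. c i * x $ i)"
      by (simp add: P_def measurable_stretch measure_stretch matrix_def axis_def det_diagonal)
  next
    fix m n :: 'n
    assume mn: "m \<noteq> n"
    show "P (\<lambda>x. \<chi> i. x $ Transposition.transpose m n i)"
      by (simp add: P_def measure_swap abs_det_swap[OF mn])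
    show "P (\<lambda>x. \<chi> i. if i = m then x $ m + x $ n else x $ i)"
      by (simp add: P_def measure_shear mn det_shear[OF mn])
  qed
  then show ?thesis
    using assms by (simp add: P_def)
qed

section \<open>Volume of a \<open>p\<close>-norm ball\<close>

lemma pnorm_scaleR:
  fixes z :: "real ^ 'n"
  assumes "1 \<le> p" "0 \<le> r"
  shows "pnorm p (r *\<^sub>R z) = r * pnorm p z"
proof (cases p)
  case (real q)
  then have q: "1 \<le> q" using assms by simp
  have "(\<Sum>l\<in>UNIV. \<bar>(r *\<^sub>R z) $ l\<bar> powr q) = r powr q * (\<Sum>l\<in>UNIV. \<bar>z $ l\<bar> powr q)"
    using assms by (simp add: abs_mult powr_mult sum_distrib_left)
  then show ?thesis
    using assms q real by (simp add: pnorm_def powr_mult powr_powr sum_nonneg)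
qed (use assms in \<open>simp_all add: pnorm_def infnorm_mul\<close>)

lemma pnorm_le_0_iff:
  fixes z :: "real ^ 'n"
  assumes "1 \<le> p"
  shows "pnorm p z \<le> 0 \<longleftrightarrow> z = 0"
proof (cases p)
  case (real q)
  have "pnorm p z \<le> 0 \<longleftrightarrow> (\<Sum>l\<in>UNIV. \<bar>z $ l\<bar> powr q) = 0"
    using real powr_ge_zero[of "\<Sum>l\<in>UNIV. \<bar>z $ l\<bar> powr q" "1 / q"] by (simp add: pnorm_def)
  also have "\<dots> \<longleftrightarrow> z = 0"
    by (simp add: sum_nonneg_eq_0_iff vec_eq_iff)
  finally show ?thesis .
next
  case PInf
  have "infnorm z \<le> 0 \<longleftrightarrow> infnorm z = 0"
    using infnorm_pos_le[of z] by linarith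
  with PInf show ?thesis
    by (simp add: pnorm_def infnorm_eq_0)
qed (use assms in simp)

text \<open>
  For \<open>r = 0\<close> both sides are \<open>{c}\<close>: definiteness of the \<open>p\<close>-norm is used on the left, nonemptiness of
  the unit ball on the right. For \<open>r > 0\<close> the map \<open>z \<mapsto> r z + c\<close> is inverted explicitly.
\<close>

lemma reach_set_ball:
  fixes c :: "real ^ 'n"
  assumes p: "1 \<le> p" and r: "0 \<le> r"
  shows "reach_set (ball_constraint p) k (c, r) = (\<lambda>z. r *\<^sub>R z + c) ` unit_pball p"
proof (cases "r = 0")
  case True
  have "(0 :: real ^ 'n) \<in> unit_pball p"
    using pnorm_le_0_iff[OF p, of "0 :: real ^ 'n"] by (simp add: unit_pball_def)
  then show ?thesis
    using True p by (auto simp: reach_set_def ball_constraint_def pnorm_le_0_iff)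
next
  case False
  with r have r0: "0 < r" by simp
  have eq: "pnorm p (r *\<^sub>R z) \<le> r \<longleftrightarrow> z \<in> unit_pball p" for z :: "real ^ 'n"
    using r0 p by (simp add: pnorm_scaleR unit_pball_def)
  show ?thesis
  proof (intro equalityI subsetI)
    fix y assume "y \<in> reach_set (ball_constraint p) k (c, r)"
    then have "(1 / r) *\<^sub>R (y - c) \<in> unit_pball p"
      using r0 by (simp add: reach_set_def ball_constraint_def flip: eq)
    moreover have "y = r *\<^sub>R ((1 / r) *\<^sub>R (y - c)) + c"
      using r0 by simp
    ultimately show "y \<in> (\<lambda>z. r *\<^sub>R z + c) ` unit_pball p"
      by blast
  qed (auto simp: reach_set_def ball_constraint_def eq)
qed

lemma Vol_reach_set_ball:
  fixes c :: "real ^ 'n"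
  assumes "1 \<le> p" "0 \<le> r"
  shows "Vol (reach_set (ball_constraint p) k (c, r))
    = Vol (unit_pball p :: (real ^ 'n) set) * r ^ CARD('n)"
  using measure_lebesgue_affine[of r c "unit_pball p"] assms
  by (simp add: reach_set_ball mult.commute)

section \<open>Volume of an ellipsoid\<close>

text \<open>
  The segment from the identity to \<open>C\<close> consists of matrices that are positive definite and hence
  regular. The determinant is continuous and nonzero along it and starts at \<open>1\<close>, so it stays
  positive.
\<close>

lemma det_spd_pos:
  fixes C :: "real ^ 'n ^ 'n"
  assumes "C \<in> spd_matrices"
  shows "0 < det C"
proof (rule ccontr)
  define A where "A t = (1 - t) *\<^sub>R mat 1 + t *\<^sub>R C" for t
  assume "\<not> 0 < det C"
  then have "det (A 1) \<le> 0" "0 \<le> det (A 0)"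
    by (simp_all add: A_def)
  moreover have "continuous_on {0..1} (\<lambda>t. det (A t))"
    unfolding det_def A_def by (simp, intro continuous_intros)
  ultimately obtain t where t: "0 \<le> t" "t \<le> 1" "det (A t) = 0"
    using IVT2'[of "\<lambda>t. det (A t)" 1 0 0] by auto
  then obtain v where v: "v \<noteq> 0" "A t *v v = 0"
    by (metis invertible_det_nz invertible_left_inverse matrix_left_invertible_ker)
  have "v \<bullet> (A t *v v) = (1 - t) * (v \<bullet> v) + t * (v \<bullet> (C *v v))"
    by (simp add: A_def matrix_vector_mult_add_rdistrib scaleR_matrix_vector_assoc[symmetric]
        inner_add_right)
  moreover have "0 < v \<bullet> v" "0 < v \<bullet> (C *v v)"
    using v assms by (auto simp: spd_matrices_def)
  then have "0 < (1 - t) * (v \<bullet> v) + t * (v \<bullet> (C *v v))"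
    using t by (cases "t = 0") (auto intro: add_nonneg_pos)
  ultimately show False
    using v by simp
qed

text \<open>
  A point \<open>x\<close> lies in the ellipsoid iff \<open>C x\<close> lies in the unit ball around \<open>- b\<close>. Hence the ellipsoid is
  the image of that ball under the inverse \<open>B\<close> of \<open>C\<close>, and \<open>\<bar>det B\<bar> = 1 / det C\<close>.
\<close>

lemma Vol_reach_set_ellipsoid:
  fixes C :: "real ^ 'n ^ 'n"
  assumes "C \<in> spd_matrices"
  shows "Vol (reach_set ellipsoid_constraint k (C, b)) = Vol (cball 0 1 :: (real ^ 'n) set) / det C"
proof -
  have d: "0 < det C" using assms by (rule det_spd_pos)
  then have "invertible C" by (simp add: invertible_det_nz)
  then obtain B where CB: "C ** B = mat 1" and BC: "B ** C = mat 1"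
    unfolding invertible_def by blast
  have "det C * det B = 1"
    using CB det_mul[of C B] by simp
  with d have detB: "\<bar>det B\<bar> = 1 / det C"
    by (metis abs_of_pos eq_divide_eq less_irrefl mult.commute zero_less_divide_1_iff)
  have mem: "z \<in> reach_set ellipsoid_constraint k (C, b) \<longleftrightarrow> C *v z \<in> cball (- b) 1" for z
  proof -
    have "dist (- b) (C *v z) = norm (C *v z + b)"
      by (subst dist_commute) (simp add: dist_norm)
    then show ?thesis
      by (simp add: reach_set_def ellipsoid_constraint_def)
  qed
  have inv: "C *v (B *v y) = y" "B *v (C *v y) = y" for y
    by (simp_all add: matrix_vector_mul_assoc CB BC)
  have "reach_set ellipsoid_constraint k (C, b) = (*v) B ` cball (- b) 1"
  proof (intro equalityI subsetI)
    fix z assume "z \<in> reach_set ellipsoid_constraint k (C, b)"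
    then have "C *v z \<in> cball (- b) 1" by (simp only: mem)
    then have "B *v (C *v z) \<in> (*v) B ` cball (- b) 1" by (rule imageI)
    then show "z \<in> (*v) B ` cball (- b) 1" by (simp only: inv)
  next
    fix z assume "z \<in> (*v) B ` cball (- b) 1"
    then obtain y where "y \<in> cball (- b) 1" "z = B *v y" by blast
    then show "z \<in> reach_set ellipsoid_constraint k (C, b)" by (simp only: mem inv)
  qed
  moreover have "Vol ((*v) B ` cball (- b) 1) = \<bar>det B\<bar> * Vol (cball (- b) 1 :: (real ^ 'n) set)"
    by (simp add: measure_linear_image_cart)
  moreover have "Vol (cball (- b) 1 :: (real ^ 'n) set) = Vol (cball 0 1 :: (real ^ 'n) set)"
    using measure_translation[of "- b" "cball 0 1"] unfolding cball_translation[symmetric] by simp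
  ultimately show ?thesis
    by (simp add: detB)
qed

section \<open>Equivalence of the programs\<close>

lemma traj_constraint_le_iff:
  "traj_constraint T g y \<theta> \<le> u \<longleftrightarrow> (\<forall>k\<in>{0..T}. g k (y k) (\<theta> k) \<le> u)"
  by (simp add: traj_constraint_def)

text \<open>
  The part of both claims that does not depend on the shape of the sets. The objectives need to agree
  only on admissible parameters, since the volume formulas hold only for \<open>r\<^sub>k \<ge> 0\<close> and for positive
  definite \<open>C\<^sub>k\<close>. Extensionality of the families makes pairing inverse to regrouping.
\<close>

lemma equivalent_via_regroup:
  assumes feas: "feasible Q = {(a, b, \<xi>). a \<in> {0..T} \<rightarrow>\<^sub>E A \<and> b \<in> {0..T} \<rightarrow>\<^sub>E B \<and>
        \<xi> \<in> {1..N} \<rightarrow>\<^sub>E {0..} \<and>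
        (\<forall>(j, k, i)\<in>constraint_index T N M. g k (x i j k) (a k, b k) \<le> \<xi> i)}"
    and obj: "\<And>a b \<xi>. a \<in> {0..T} \<rightarrow>\<^sub>E A \<Longrightarrow> b \<in> {0..T} \<rightarrow>\<^sub>E B \<Longrightarrow> objective Q (a, b, \<xi>)
        = (\<Sum>k\<in>{0..T}. S (reach_set g k (a k, b k)) + \<rho> * (\<Sum>i\<in>{1..N}. \<xi> i))"
  shows "equivalent_via (regroup T)
    (adversarial_program T N \<rho> M x S g ({0..T} \<rightarrow>\<^sub>E A \<times> B)) Q"
proof -
  let ?P = "adversarial_program T N \<rho> M x S g ({0..T} \<rightarrow>\<^sub>E A \<times> B)"
  let ?pair = "\<lambda>(a, b, \<xi>). (\<lambda>k\<in>{0..T}. (a k, b k), \<xi>)"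
  have memP: "(\<theta>, \<xi>) \<in> feasible ?P \<longleftrightarrow> \<theta> \<in> {0..T} \<rightarrow>\<^sub>E A \<times> B \<and> \<xi> \<in> {1..N} \<rightarrow>\<^sub>E {0..} \<and>
      (\<forall>j k i. (j, k, i) \<in> constraint_index T N M \<longrightarrow> g k (x i j k) (\<theta> k) \<le> \<xi> i)" for \<theta> \<xi>
    unfolding adversarial_program_def constraint_index_def traj_constraint_le_iff by auto
  have memQ: "(a, b, \<xi>) \<in> feasible Q \<longleftrightarrow> a \<in> {0..T} \<rightarrow>\<^sub>E A \<and> b \<in> {0..T} \<rightarrow>\<^sub>E B \<and>
      \<xi> \<in> {1..N} \<rightarrow>\<^sub>E {0..} \<and>
      (\<forall>j k i. (j, k, i) \<in> constraint_index T N M \<longrightarrow> g k (x i j k) (a k, b k) \<le> \<xi> i)" for a b \<xi>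
    unfolding feas by auto
  have index: "k \<in> {0..T}" if "(j, k, i) \<in> constraint_index T N M" for j k i
    using that by (simp add: constraint_index_def)
  have "bij_betw (regroup T) (feasible ?P) (feasible Q)"
  proof (rule bij_betw_byWitness[where f' = ?pair])
    show "\<forall>v\<in>feasible ?P. ?pair (regroup T v) = v"
    proof clarify
      fix \<theta> \<xi> assume "(\<theta>, \<xi>) \<in> feasible ?P"
      then have "\<theta> \<in> extensional {0..T}"
        unfolding memP PiE_iff by blast
      then have "(\<lambda>k\<in>{0..T}. \<theta> k) = \<theta>"
        by (rule extensional_restrict)
      then show "?pair (regroup T (\<theta>, \<xi>)) = (\<theta>, \<xi>)"
        by (simp add: regroup_def cong: restrict_cong)
    qed
    show "\<forall>w\<in>feasible Q. regroup T (?pair w) = w"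
    proof
      fix w assume w: "w \<in> feasible Q"
      obtain a b \<xi> where w_eq: "w = (a, b, \<xi>)"
        by (cases w) auto
      have "a \<in> extensional {0..T}" "b \<in> extensional {0..T}"
        using w unfolding w_eq memQ PiE_iff by blast+
      then have "(\<lambda>k\<in>{0..T}. a k) = a" "(\<lambda>k\<in>{0..T}. b k) = b"
        by (simp_all only: extensional_restrict)
      then show "regroup T (?pair w) = w"
        by (simp add: w_eq regroup_def cong: restrict_cong)
    qed
    show "regroup T ` feasible ?P \<subseteq> feasible Q"
    proof (rule image_subsetI)
      fix v assume v: "v \<in> feasible ?P"
      obtain \<theta> \<xi> where v_eq: "v = (\<theta>, \<xi>)"
        by (cases v)
      have "(\<lambda>k\<in>{0..T}. fst (\<theta> k), \<lambda>k\<in>{0..T}. snd (\<theta> k), \<xi>) \<in> feasible Q"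
        using v unfolding v_eq memP memQ by (auto simp: PiE_iff mem_Times_iff dest: index)
      then show "regroup T v \<in> feasible Q"
        by (simp add: v_eq regroup_def)
    qed
    show "?pair ` feasible Q \<subseteq> feasible ?P"
    proof (rule image_subsetI)
      fix w assume w: "w \<in> feasible Q"
      obtain a b \<xi> where w_eq: "w = (a, b, \<xi>)"
        by (cases w) auto
      show "?pair w \<in> feasible ?P"
        using w unfolding w_eq memQ prod.case memP by (auto simp: PiE_iff dest: index)
    qed
  qed
  moreover have "objective Q (regroup T v) = objective ?P v" if "v \<in> feasible ?P" for v
  proof -
    obtain \<theta> \<xi> where v: "v = (\<theta>, \<xi>)"
      by (cases v)
    have \<theta>: "\<theta> \<in> {0..T} \<rightarrow>\<^sub>E A \<times> B"
      using that unfolding v memP by blast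
    have "(\<lambda>k\<in>{0..T}. fst (\<theta> k)) \<in> {0..T} \<rightarrow>\<^sub>E A" "(\<lambda>k\<in>{0..T}. snd (\<theta> k)) \<in> {0..T} \<rightarrow>\<^sub>E B"
      using \<theta> by (auto simp: PiE_iff mem_Times_iff)
    then show ?thesis
      by (simp add: v regroup_def obj adversarial_program_def)
  qed
  ultimately show ?thesis
    by (simp add: equivalent_via_def)
qed

theorem lemma1:
  fixes T N :: nat and \<rho> :: real and p :: ereal
    and M :: "nat \<Rightarrow> 'j set" and x :: "nat \<Rightarrow> 'j \<Rightarrow> nat \<Rightarrow> real ^ 'n"
    and S :: "(real ^ 'n) set \<Rightarrow> real"
  assumes "\<rho> > 0" and "\<And>i. i \<in> {1..N} \<Longrightarrow> finite (M i)"
  shows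
    "(1 \<le> p \<and>
      (\<forall>k\<in>{0..T}. \<forall>c. \<forall>r\<ge>0. S (reach_set (ball_constraint p) k (c, r))
         = Vol (reach_set (ball_constraint p) k (c, r))) \<longrightarrow>
      equivalent_via (regroup T)
        (adversarial_program T N \<rho> M x S (ball_constraint p) (ball_params T))
        (ball_program T N \<rho> M x p)) \<and>
     ((\<forall>k\<in>{0..T}. \<forall>C\<in>spd_matrices. \<forall>b. S (reach_set ellipsoid_constraint k (C, b))
         = Vol (reach_set ellipsoid_constraint k (C, b))) \<longrightarrow>
      equivalent_via (regroup T)
        (adversarial_program T N \<rho> M x S ellipsoid_constraint (ellipsoid_params T))
        (ellipsoid_program T N \<rho> M x))"
proof (intro conjI impI)
  assume *: "1 \<le> p \<and> (\<forall>k\<in>{0..T}. \<forall>c. \<forall>r\<ge>0. S (reach_set (ball_constraint p) k (c, r))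
         = Vol (reach_set (ball_constraint p) k (c, r)))"
  show "equivalent_via (regroup T)
        (adversarial_program T N \<rho> M x S (ball_constraint p) (ball_params T))
        (ball_program T N \<rho> M x p)"
    unfolding ball_params_def
  proof (rule equivalent_via_regroup)
    fix c :: "nat \<Rightarrow> real ^ 'n" and r \<xi> :: "nat \<Rightarrow> real"
    assume "r \<in> {0..T} \<rightarrow>\<^sub>E {0..}"
    then have "S (reach_set (ball_constraint p) k (c k, r k))
        = Vol (unit_pball p :: (real ^ 'n) set) * r k ^ CARD('n)" if "k \<in> {0..T}" for k
      using * that by (auto simp: PiE_iff Vol_reach_set_ball)
    then show "objective (ball_program T N \<rho> M x p) (c, r, \<xi>)
        = (\<Sum>k\<in>{0..T}. S (reach_set (ball_constraint p) k (c k, r k)) + \<rho> * (\<Sum>i\<in>{1..N}. \<xi> i))"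
      by (simp add: ball_program_def)
  qed (simp add: ball_program_def ball_constraint_def algebra_simps)
next
  assume *: "\<forall>k\<in>{0..T}. \<forall>C\<in>spd_matrices. \<forall>b. S (reach_set ellipsoid_constraint k (C, b))
         = Vol (reach_set ellipsoid_constraint k (C, b))"
  show "equivalent_via (regroup T)
        (adversarial_program T N \<rho> M x S ellipsoid_constraint (ellipsoid_params T))
        (ellipsoid_program T N \<rho> M x)"
    unfolding ellipsoid_params_def
  proof (rule equivalent_via_regroup)
    fix C :: "nat \<Rightarrow> real ^ 'n ^ 'n" and b :: "nat \<Rightarrow> real ^ 'n" and \<xi> :: "nat \<Rightarrow> real"
    assume "C \<in> {0..T} \<rightarrow>\<^sub>E spd_matrices"
    then have "S (reach_set ellipsoid_constraint k (C k, b k))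
        = Vol (cball 0 1 :: (real ^ 'n) set) / det (C k)" if "k \<in> {0..T}" for k
      using * that by (auto simp: PiE_iff Vol_reach_set_ellipsoid)
    then show "objective (ellipsoid_program T N \<rho> M x) (C, b, \<xi>)
        = (\<Sum>k\<in>{0..T}. S (reach_set ellipsoid_constraint k (C k, b k)) + \<rho> * (\<Sum>i\<in>{1..N}. \<xi> i))"
      by (simp add: ellipsoid_program_def)
  qed (simp add: ellipsoid_program_def ellipsoid_constraint_def algebra_simps)
qed

end
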